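(* Let $q=2^r$ with $r\ge1$. Let $\chi$ be a primitive character modulo $R_{3,q}$. If we factor $L(u,\chi)$ as $$L(u,\chi)=(1-\gamma_1(\chi)u)(1-\gamma_2(\chi)u),$$ then $\frac{\gamma_1(\chi)}{\sqrt q}$ and $\frac{\gamma_2(\chi)}{\sqrt q}$ are roots of unity of order dividing $24$.
   Context: $\mathcal{M}_q$ is the set of monic polynomials in $\mathbb{F}_q[T]$. The $j$-th next-to-leading coefficient of $f\in\mathcal{M}_q$ is the coefficient of $T^{\deg f-j}$ in $f$, taken to be $0$ if $j>\deg f$. For $\ell\in\mathbb{N}=\{0,1,2,\dots\}$, the equivalence relation $R_\ell=R_{\ell,q}$ on $\mathcal{M}_q$ is: $A\equiv B\bmod R_\ell$ iff $A$ and $B$ have the same first $\ell$ next-to-leading coefficients. The quotient $\mathcal{M}_q/R_\ell$ is an abelian group of order $q^\ell$ under polynomial multiplication, with identity the class of $1$. $G(R_\ell)=G(R_{\ell,q})$ denotes the set of functions $\mathcal{M}_q\to\mathbb{C}^\times$ obtained by composing a character of $\mathcal{M}_q/R_\ell$ with the projection $\mathcal{M}_q\to\mathcal{M}_q/R_\ell$; thus $G(R_{\ell-1})\subseteq G(R_\ell)$. For $\ell>0$, a character $\chi\in G(R_\ell)$ is primitive modulo $R_\ell$ if $\chi\notin G(R_{\ell-1})$. The $L$-function of $\chi$ is the power series $L(u,\chi)=\sum_{f\in\mathcal{M}_q}\chi(f)u^{\deg f}$; for nontrivial $\chi\in G(R_\ell)$ it is a polynomial of degree at most $\ell-1$, and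 it has degree exactly $\ell-1$ if $\chi$ is primitive modulo $R_\ell$. *)

theory Defs
  imports
    Complex_Main
    "HOL-Library.Cardinality"
    "HOL-Computational_Algebra.Polynomial"
    "HOL-Computational_Algebra.Formal_Power_Series"
    "HOL-Algebra.Group"
begin

text \<open>
  The field \<open>F\<^sub>q\<close> is a type \<open>'a :: {field, finite}\<close> with \<open>q = CARD('a)\<close>.
\<close>

definition monic_polys :: "'a::{field, finite} poly set" where
  "monic_polys = {f. lead_coeff f = 1}"

definition next_coeff :: "nat \<Rightarrow> 'a::{field, finite} poly \<Rightarrow> 'a" where
  "next_coeff j f = (if j \<le> degree f then coeff f (degree f - j) else 0)"

definition R_rel :: "nat \<Rightarrow> ('a::{field, finite} poly \<times> 'a poly) set" where
  "R_rel l = {(A, B). A \<in> monic_polys \<and> B \<in> monic_polys \<and>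
                      (\<forall>j\<in>{1..l}. next_coeff j A = next_coeff j B)}"

lemma equiv_R_rel: "equiv monic_polys (R_rel l)"
  by (rule equivI) (auto simp: R_rel_def refl_on_def sym_def trans_def)

text \<open>The union below is that of a single class, by \<open>R_group_mult\<close>.\<close>

definition R_group :: "nat \<Rightarrow> 'a::{field, finite} poly set monoid" where
  "R_group l = \<lparr>carrier = monic_polys // R_rel l,
                mult = (\<lambda>A B. \<Union>f\<in>A. \<Union>g\<in>B. R_rel l `` {f * g}),
                one = R_rel l `` {1}\<rparr>"

lemma next_coeff_mult:
  assumes "f \<in> monic_polys" "g \<in> monic_polys"
  shows "next_coeff j (f * g) = (\<Sum>i\<le>j. next_coeff i f * next_coeff (j - i) g)"
proof -
  have nc: "next_coeff i h = coeff (reflect_poly h) i" for i and h :: "'a poly"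
    by (simp add: next_coeff_def coeff_reflect_poly)
  show ?thesis
    by (simp add: nc reflect_poly_mult coeff_mult)
qed

lemma R_rel_mult:
  assumes "(f, f') \<in> R_rel l" "(g, g') \<in> R_rel l"
  shows "(f * g, f' * g') \<in> R_rel l"
proof -
  have m: "f \<in> monic_polys" "f' \<in> monic_polys" "g \<in> monic_polys" "g' \<in> monic_polys"
    using assms by (auto simp: R_rel_def)
  have e: "next_coeff j h = next_coeff j h'" if "(h, h') \<in> R_rel l" "j \<le> l" for j h h'
    using that by (cases "j = 0") (simp_all add: R_rel_def next_coeff_def monic_polys_def)
  note e = e[OF assms(1)] e[OF assms(2)]
  have "next_coeff j (f * g) = next_coeff j (f' * g')" if "j \<le> l" for j
    unfolding next_coeff_mult[OF m(1,3)] next_coeff_mult[OF m(2,4)]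
    using that by (intro sum.cong) (auto simp: e)
  moreover have "f * g \<in> monic_polys" "f' * g' \<in> monic_polys"
    using m by (auto simp: monic_polys_def lead_coeff_mult)
  ultimately show ?thesis by (auto simp: R_rel_def)
qed

lemma R_group_mult:
  assumes "f \<in> monic_polys" "g \<in> monic_polys"
  shows "R_rel l `` {f} \<otimes>\<^bsub>R_group l\<^esub> R_rel l `` {g} = R_rel l `` {f * g}"
proof -
  have r: "(f, f) \<in> R_rel l" "(g, g) \<in> R_rel l"
    using assms by (auto simp: R_rel_def)
  have "R_rel l `` {f' * g'} = R_rel l `` {f * g}"
    if "(f, f') \<in> R_rel l" "(g, g') \<in> R_rel l" for f' g'
    using equiv_class_eq[OF equiv_R_rel R_rel_mult[OF that]] by simp
  then have "(\<Union>f'\<in>R_rel l `` {f}. \<Union>g'\<in>R_rel l `` {g}. R_rel l `` {f' * g'}) = R_rel l `` {f * g}"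
    using r by blast
  then show ?thesis by (simp add: R_group_def)
qed

definition complex_units :: "complex monoid" where
  "complex_units = \<lparr>carrier = UNIV - {0}, mult = (*), one = 1\<rparr>"

text \<open>
  Elements of \<open>G(R\<^sub>l)\<close> are functions on the monic polynomials, hence \<open>undefined\<close>
  on all other polynomials.
\<close>

definition G_chars :: "nat \<Rightarrow> ('a::{field, finite} poly \<Rightarrow> complex) set" where
  "G_chars l = (\<lambda>\<psi>. \<lambda>f\<in>monic_polys. \<psi> (R_rel l `` {f})) ` hom (R_group l) complex_units"

definition primitive_char :: "nat \<Rightarrow> ('a::{field, finite} poly \<Rightarrow> complex) \<Rightarrow> bool" where
  "primitive_char l \<chi> \<longleftrightarrow> l > 0 \<and> \<chi> \<in> G_chars l \<and> \<chi> \<notin> G_chars (l - 1)"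

definition L_fun :: "('a::{field, finite} poly \<Rightarrow> complex) \<Rightarrow> complex fps" where
  "L_fun \<chi> = Abs_fps (\<lambda>n. \<Sum>f\<in>{f \<in> monic_polys. degree f = n}. \<chi> f)"

text \<open>The sums in \<open>L_fun\<close> are over finite sets, so none of them is \<open>0\<close> by convention.\<close>

lemma finite_monic_degree: "finite {f \<in> monic_polys :: 'a::{field, finite} poly set. degree f = n}"
proof (rule finite_subset)
  show "{f \<in> monic_polys :: 'a poly set. degree f = n}
          \<subseteq> Poly ` {xs. set xs \<subseteq> UNIV \<and> length xs \<le> Suc n}"
  proof
    fix f :: "'a poly" assume "f \<in> {f \<in> monic_polys. degree f = n}"
    then have "length (coeffs f) \<le> Suc n" by (cases "f = 0") (auto simp: length_coeffs_degree)
    then show "f \<in> Poly ` {xs. set xs \<subseteq> UNIV \<and> length xs \<le> Suc n}"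
      by (intro image_eqI[of _ _ "coeffs f"]) auto
  qed
qed (intro finite_imageI finite_lists_length_le finite)

end

theory Submission imports Defs begin

text \<open>
  Write \<open>x\<close> for \<open>1/T\<close>. A character \<open>\<chi>\<close> modulo \<open>R\<^sub>3\<close> is a character of the group of truncated
  series \<open>1 + a x + b x\<^sup>2 + c x\<^sup>3\<close> modulo \<open>x\<^sup>4\<close>, and it is determined by the functions
  \<open>f a = \<chi> (1 + a x)\<close>, \<open>g b = \<chi> (1 + b x\<^sup>2)\<close> and \<open>h c = \<chi> (1 + c x\<^sup>3)\<close>. Here \<open>g\<close> and \<open>h\<close> are
  additive characters of the field, \<open>h\<close> is nontrivial because \<open>\<chi>\<close> is primitive, and in
  characteristic 2 one has \<open>f a * f b = f (a + b) * g (a b) * h (a b (a + b))\<close>.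
  In particular \<open>f\<close> takes values in the fourth roots of unity.

  By duality for additive characters there is an \<open>e\<close> with \<open>g b = h (e b)\<close> for all \<open>b\<close>. Then:

  \<^item> the coefficient of \<open>u\<^sup>2\<close> in the \<open>L\<close>-function is \<open>q * f e\<close>, by orthogonality
    (\<open>second_coeff\<close>);
  \<^item> the coefficient \<open>S\<close> of \<open>u\<close> satisfies \<open>S = f e * cnj S\<close>, by the substitution
    \<open>a \<mapsto> a + e\<close> (\<open>functional_equation\<close>);
  \<^item> \<open>S * cnj S = q * m\<close> with an integer \<open>m\<close> between 0 and 4 (\<open>norm_first_coeff\<close>): expanding the
    square, \<open>m\<close> is the sum of \<open>f\<close> over the radical of the pairing
    \<open>(a, b) \<mapsto> g (a b) * h (a b (a + b))\<close>. The function \<open>f\<close> is \<open>\<plusminus>1\<close> on the radical, and the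
    square roots of its elements are zeros of a polynomial of degree 4.

  Thus the normalized inverse roots \<open>\<alpha>\<close> have product \<open>\<epsilon> = f e\<close> with \<open>\<epsilon>\<^sup>4 = 1\<close> and a sum whose
  square is \<open>\<epsilon> m\<close>. Hence \<open>z = \<alpha>\<^sup>2/\<epsilon>\<close> satisfies \<open>z\<^sup>2 + (2 - m) z + 1 = 0\<close>; for each of the five
  values of \<open>m\<close> this forces \<open>z\<^sup>1\<^sup>2 = 1\<close>, and so \<open>\<alpha>\<^sup>2\<^sup>4 = 1\<close>.
\<close>

section \<open>Additive characters of a finite field\<close>

text \<open>A character of the additive group, as a nowhere vanishing function on the whole field.\<close>

definition add_char :: "('a::{field, finite} \<Rightarrow> complex) \<Rightarrow> bool" where
  "add_char \<phi> \<longleftrightarrow> (\<forall>x y. \<phi> (x + y) = \<phi> x * \<phi> y) \<and> (\<forall>x. \<phi> x \<noteq> 0)"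

lemma add_char_add: "add_char \<phi> \<Longrightarrow> \<phi> (x + y) = \<phi> x * \<phi> y"
  by (simp add: add_char_def)

lemma add_char_nonzero: "add_char \<phi> \<Longrightarrow> \<phi> x \<noteq> 0"
  by (simp add: add_char_def)

lemma add_char_0: "add_char \<phi> \<Longrightarrow> \<phi> 0 = 1"
  using add_char_add[of \<phi> 0 0] add_char_nonzero[of \<phi> 0] by simp

lemma add_char_mult:
  "add_char \<phi> \<Longrightarrow> add_char \<theta> \<Longrightarrow> add_char (\<lambda>x. \<phi> x * \<theta> x)"
  by (simp add: add_char_def)

lemma add_char_scale: "add_char \<phi> \<Longrightarrow> add_char (\<lambda>x. \<phi> (a * x))"
  by (simp add: add_char_def distrib_left)

lemma sum_shift:
  fixes F :: "'a::{ab_group_add, finite} \<Rightarrow> 'b::comm_monoid_add"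
  shows "(\<Sum>x\<in>UNIV. F (x + c)) = (\<Sum>x\<in>UNIV. F x)"
  by (rule sum.reindex_bij_witness[of _ "\<lambda>x. x - c" "\<lambda>x. x + c"]) auto

lemma sum_add_char:
  fixes \<phi> :: "'a::{field, finite} \<Rightarrow> complex"
  assumes "add_char \<phi>"
  shows "(\<Sum>x\<in>UNIV. \<phi> x) = (if \<forall>x. \<phi> x = 1 then of_nat CARD('a) else 0)"
proof (cases "\<forall>x. \<phi> x = 1")
  case False
  then obtain c where c: "\<phi> c \<noteq> 1" by blast
  have "(\<Sum>x\<in>UNIV. \<phi> x) = (\<Sum>x\<in>UNIV. \<phi> (x + c))"
    by (rule sum_shift[symmetric])
  also have "\<dots> = (\<Sum>x\<in>UNIV. \<phi> x) * \<phi> c"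
    by (simp add: add_char_add[OF assms] sum_distrib_right)
  finally show ?thesis using c False by simp
qed simp

lemma add_char_scale_trivial:
  assumes "add_char h" "h c \<noteq> 1" "\<forall>x. h (a * x) = 1"
  shows "a = 0"
  using assms(2) spec[OF assms(3), of "c / a"] by (cases "a = 0") auto

text \<open>
  Self-duality of the additive group: averaging \<open>g b * h (- (a b))\<close> over both \<open>a\<close> and \<open>b\<close> shows
  that not all of the characters \<open>b \<mapsto> g b * h (- (a b))\<close> can be nontrivial.
\<close>

lemma add_char_dual:
  fixes g h :: "'a::{field, finite} \<Rightarrow> complex"
  assumes g: "add_char g" and h: "add_char h" and c: "h c \<noteq> 1"
  obtains e where "\<And>x. g x = h (e * x)"
proof -
  have "(\<Sum>a\<in>UNIV. \<Sum>x\<in>UNIV. g x * h (- a * x)) = (\<Sum>x\<in>UNIV. g x * (\<Sum>a\<in>UNIV. h (- x * a)))"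
    by (subst sum.swap) (simp add: sum_distrib_left mult.commute)
  also have "\<dots> = (\<Sum>x\<in>(UNIV::'a set). if x = 0 then of_nat CARD('a) else 0)"
  proof (rule sum.cong)
    fix x :: 'a
    show "g x * (\<Sum>a\<in>UNIV. h (- x * a)) = (if x = 0 then of_nat CARD('a) else 0)"
      using sum_add_char[OF add_char_scale[OF h, of "- x"]] add_char_scale_trivial[OF h c, of "- x"]
      by (auto simp: add_char_0 g h)
  qed simp
  also have "\<dots> \<noteq> 0" by simp
  finally obtain a where a: "(\<Sum>x\<in>UNIV. g x * h (- a * x)) \<noteq> 0"
    by (meson sum.neutral)
  then have *: "g x * h (- a * x) = 1" for x
    using sum_add_char[OF add_char_mult[OF g add_char_scale[OF h, of "- a"]]]
    by (auto split: if_splits)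
  have "g x = h (a * x)" for x
  proof -
    have "h (a * x) * h (- a * x) = 1"
      using add_char_add[OF h, of "a * x" "- a * x"] by (simp add: add_char_0 h)
    with *[of x] show ?thesis
      using add_char_nonzero[OF h, of "- a * x"] by (metis mult_right_cancel)
  qed
  then show ?thesis using that by blast
qed

lemma two_eq_0_of_card:
  assumes "CARD('a::{field, finite}) = 2 ^ r"
  shows "(2::'a) = 0"
proof -
  have "(\<Sum>x\<in>(UNIV::'a set). x + 1) = (\<Sum>x\<in>(UNIV::'a set). x)"
    by (rule sum_shift[where F = "\<lambda>x. x"])
  then have "(of_nat CARD('a) :: 'a) = 0"
    by (simp add: sum.distrib)
  then show ?thesis using assms by simp
qed

section \<open>The two coefficients of the L-function\<close>

text \<open>
  The three functions \<open>f\<close>, \<open>g\<close>, \<open>h\<close> through which a primitive character modulo \<open>R\<^sub>3\<close> is given in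
  characteristic 2: its values at \<open>T + a\<close>, \<open>T\<^sup>2 + b\<close> and \<open>T\<^sup>3 + c\<close>. The parameter \<open>e\<close>
  expresses \<open>g\<close> in terms of \<open>h\<close>; it exists by \<open>add_char_dual\<close>.
\<close>

locale char_data =
  fixes f g h :: "'a::{field, finite} \<Rightarrow> complex" and e :: 'a
  assumes two: "(2::'a) = 0"
    and g: "add_char g" and h: "add_char h"
    and h_nontrivial: "\<exists>c. h c \<noteq> 1"
    and f_nonzero: "f a \<noteq> 0"
    and f_mult: "f a * f b = f (a + b) * g (a * b) * h (a * b * (a + b))"
    and g_eq: "g b = h (e * b)"
begin

lemma add_self: "(x::'a) + x = 0"
  using two by (metis mult_2 mult_zero_left)

lemma minus_eq: "- (x::'a) = x"
  using add_self by (metis minus_unique)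

lemma square_add: "(x + y) * (x + y) = x * x + y * (y::'a)"
proof -
  have "(x + y) * (x + y) = x * x + y * y + (x * y + x * y)" by (simp add: algebra_simps)
  then show ?thesis by (simp add: add_self)
qed

lemma g_sq: "g b * g b = 1"
  using add_char_add[OF g, of b b] by (simp add: add_self add_char_0 g)

lemma h_sq: "h b * h b = 1"
  using add_char_add[OF h, of b b] by (simp add: add_self add_char_0 h)

lemma h_trivial: "(\<forall>x. h (a * x) = 1) \<Longrightarrow> a = 0"
  using h_nontrivial add_char_scale_trivial[OF h] by blast

lemma f_0: "f 0 = 1"
  using f_mult[of 0 0] f_nonzero[of 0] by (simp add: add_char_0 g h)

lemma f_sq: "f a * f a = g (a * a)"
  using f_mult[of a a] by (simp add: add_self add_char_0 h f_0)

lemma f_4: "f a ^ 4 = 1"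
  using f_sq[of a] g_sq[of "a * a"] by (metis mult.assoc power4_eq_xxxx)

lemma cnj_f: "cnj (f a) = f a * g (a * a)"
proof -
  have "norm (f a) ^ 4 = 1" by (simp add: f_4 flip: norm_power)
  then have "norm (f a) = 1" using power_eq_imp_eq_base[of "norm (f a)" 4 1] by simp
  then have "f a * cnj (f a) = 1" by (simp add: complex_norm_square[symmetric])
  moreover have "f a * (f a * g (a * a)) = 1"
    using f_sq[of a] g_sq[of "a * a"] by (simp add: mult.assoc[symmetric])
  ultimately show ?thesis using f_nonzero[of a] by (metis mult_left_cancel)
qed

lemma second_coeff: "(\<Sum>a\<in>UNIV. \<Sum>b\<in>UNIV. f a * g b * h (a * b)) = of_nat CARD('a) * f e"
proof -
  have "(\<Sum>b\<in>UNIV. f a * g b * h (a * b)) = (if a = e then of_nat CARD('a) * f e else 0)" for a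
  proof -
    have "(\<Sum>b\<in>UNIV. f a * g b * h (a * b)) = f a * (\<Sum>b\<in>UNIV. h ((a + e) * b))"
      by (simp only: g_eq add_char_add[OF h] distrib_right sum_distrib_left) (simp only: mult_ac)
    also have "\<dots> = f a * (if a + e = 0 then of_nat CARD('a) else 0)"
      using sum_add_char[OF add_char_scale[OF h, of "a + e"]] h_trivial[of "a + e"]
      by (auto simp: add_char_0 h)
    also have "a + e = 0 \<longleftrightarrow> a = e"
      by (metis add_eq_0_iff minus_eq)
    finally show ?thesis by simp
  qed
  then show ?thesis by simp
qed

lemma functional_equation: "(\<Sum>a\<in>UNIV. f a) = f e * cnj (\<Sum>a\<in>UNIV. f a)"
proof -
  have "f e * cnj (f a) = f (a + e)" for a
  proof -
    have "h (a * e * (a + e)) = g (a * a) * g (a * e)"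
      by (simp add: g_eq algebra_simps flip: add_char_add[OF h])
    then have "f a * f e = f (a + e) * g (a * a) * (g (a * e) * g (a * e))"
      by (simp add: f_mult mult_ac)
    then have "f a * f e = f (a + e) * g (a * a)" by (simp add: g_sq)
    then have "f e * cnj (f a) = f (a + e) * (g (a * a) * g (a * a))"
      by (simp add: cnj_f mult_ac)
    then show ?thesis by (simp add: g_sq)
  qed
  then show ?thesis
    using sum_shift[of f e] by (simp add: sum_distrib_left)
qed

text \<open>The radical of the pairing that measures by how much \<open>f\<close> fails to be multiplicative.\<close>

definition radical :: "'a set" where
  "radical = {a. \<forall>b. g (a * b) * h (a * b * (a + b)) = 1}"

lemma pairing_eq: "g (a * b) * h (a * b * (a + b)) = h (e * a * b + a * a * b + a * (b * b))"
  by (simp add: g_eq algebra_simps flip: add_char_add[OF h])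

lemma add_char_pairing: "add_char (\<lambda>b. g (a * b) * h (a * b * (a + b)))"
  unfolding pairing_eq add_char_def square_add unfolding distrib_left add_char_add[OF h]
  by (simp add: add_char_nonzero[OF h] mult_ac)

text \<open>
  The character \<open>x \<mapsto> h (x\<^sup>2)\<close> has the form \<open>x \<mapsto> h (k x)\<close>, so for \<open>a = s\<^sup>2\<close> the pairing of \<open>a\<close>
  with \<open>b\<close> is \<open>h ((s\<^sup>4 + e s\<^sup>2 + k s) b)\<close>. Membership of \<open>a\<close> in the radical is therefore a quartic
  equation for its square root.
\<close>

lemma card_radical: "card radical \<le> 4"
proof -
  have "add_char (\<lambda>x. h (x * x))"
    unfolding add_char_def square_add using add_char_add[OF h] add_char_nonzero[OF h] by blast
  moreover obtain c where "h c \<noteq> 1" using h_nontrivial by blast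
  ultimately obtain k where k: "\<And>x. h (x * x) = h (k * x)"
    using add_char_dual[OF _ h] by blast
  have "inj (\<lambda>x::'a. x * x)"
  proof (rule injI)
    fix x y :: 'a
    assume "x * x = y * y"
    then have "(x + y) * (x + y) = 0" unfolding square_add by (simp only: add_self)
    then show "x = y" by (metis add_eq_0_iff minus_eq mult_eq_0_iff)
  qed
  then have surj: "surj (\<lambda>x::'a. x * x)" by (simp add: finite_UNIV_inj_surj)
  define P where "P = [:0, k, e, 0, 1:]"
  have P0: "P \<noteq> 0" by (simp add: P_def)
  have "radical \<subseteq> (\<lambda>x. x * x) ` {x. poly P x = 0}"
  proof
    fix a
    assume "a \<in> radical"
    obtain s where s: "a = s * s" using surj by (auto simp: surj_def)
    have "h (poly P s * b) = 1" for b
    proof -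
      have "poly P s * b = (e * a * b + a * a * b) + k * (s * b)"
        by (simp add: P_def s algebra_simps)
      then have "h (poly P s * b) = h (e * a * b + a * a * b) * h ((s * b) * (s * b))"
        by (simp only: add_char_add[OF h] k)
      also have "(s * b) * (s * b) = a * (b * b)"
        by (simp add: s mult_ac)
      also have "h (e * a * b + a * a * b) * h (a * (b * b)) = g (a * b) * h (a * b * (a + b))"
        by (simp only: pairing_eq add_char_add[OF h])
      also have "\<dots> = 1"
        using \<open>a \<in> radical\<close> by (simp add: radical_def)
      finally show ?thesis .
    qed
    then have "poly P s = 0" using h_trivial by blast
    then show "a \<in> (\<lambda>x. x * x) ` {x. poly P x = 0}" using s by blast
  qed
  then have "card radical \<le> card {x. poly P x = 0}"
    by (meson card_image_le card_mono finite finite_imageI order_trans)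
  also have "\<dots> \<le> degree P" using P0 by (rule card_poly_roots_bound)
  also have "\<dots> = 4" by (simp add: P_def)
  finally show ?thesis .
qed

lemma f_radical: "a \<in> radical \<Longrightarrow> f a = 1 \<or> f a = - 1"
proof -
  assume "a \<in> radical"
  then have "g (a * a) * h (a * a * (a + a)) = 1" unfolding radical_def by blast
  then have "f a * f a = 1" by (simp add: f_sq add_self add_char_0 h)
  then show ?thesis by (simp add: square_eq_1_iff)
qed

lemma norm_first_coeff:
  obtains m :: int where "0 \<le> m" "m \<le> 4"
    "(\<Sum>a\<in>UNIV. f a) * cnj (\<Sum>a\<in>UNIV. f a) = of_nat CARD('a) * of_int m"
proof -
  let ?S = "\<Sum>a\<in>UNIV. f a"
  let ?q = "of_nat CARD('a) :: complex"
  define v where "v a = (if f a = 1 then 1 else - 1 :: int)" for a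
  define m where "m = (\<Sum>a\<in>radical. v a)"
  have pair: "f (a + b) * cnj (f b) = f a * (g (a * b) * h (a * b * (a + b)))" for a b
  proof -
    let ?p = "g (a * b) * h (a * b * (a + b))"
    have "?p * ?p = (g (a * b) * g (a * b)) * (h (a * b * (a + b)) * h (a * b * (a + b)))"
      by (simp only: mult_ac)
    also have "\<dots> = 1" by (simp only: g_sq h_sq mult_1_left)
    finally have "?p * ?p = 1" .
    moreover have "f a * f b = f (a + b) * ?p" by (simp add: f_mult mult.assoc)
    ultimately have "f (a + b) = f a * f b * ?p" by (metis mult.assoc mult.right_neutral)
    moreover have "f b * cnj (f b) = 1"
      by (metis cnj_f f_sq g_sq mult.assoc)
    ultimately show ?thesis by (metis (no_types, lifting) mult.assoc mult.commute mult.right_neutral)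
  qed
  \<comment> \<open>Substituting \<open>a + b\<close> for \<open>a\<close> in the double sum turns the sum over \<open>b\<close> into a sum of an
    additive character, which vanishes unless \<open>a\<close> lies in the radical.\<close>
  have "?S * cnj ?S = (\<Sum>b\<in>UNIV. (\<Sum>a\<in>UNIV. f (a + b)) * cnj (f b))"
    by (simp add: sum_shift sum_distrib_left)
  also have "\<dots> = (\<Sum>a\<in>UNIV. \<Sum>b\<in>UNIV. f (a + b) * cnj (f b))"
    by (subst sum.swap) (simp add: sum_distrib_right)
  also have "\<dots> = (\<Sum>a\<in>UNIV. f a * (\<Sum>b\<in>UNIV. g (a * b) * h (a * b * (a + b))))"
    by (simp only: pair sum_distrib_left)
  also have "\<dots> = (\<Sum>a\<in>UNIV. if a \<in> radical then ?q * f a else 0)"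
    by (rule sum.cong) (simp_all only: sum_add_char[OF add_char_pairing], auto simp: radical_def)
  also have "\<dots> = ?q * (\<Sum>a\<in>radical. f a)"
    by (simp add: sum.If_cases sum_distrib_left)
  also have "(\<Sum>a\<in>radical. f a) = of_int m"
    unfolding m_def of_int_sum using f_radical by (intro sum.cong) (auto simp: v_def)
  finally have eq: "?S * cnj ?S = ?q * of_int m" .
  have "real CARD('a) * of_int m \<ge> 0"
  proof -
    have "complex_of_real (norm ?S ^ 2) = complex_of_real (real CARD('a) * of_int m)"
      using eq by (simp only: complex_norm_square) simp
    then show ?thesis by (metis of_real_eq_iff zero_le_power2)
  qed
  then have "0 \<le> m" by (simp add: zero_le_mult_iff)
  moreover have "m \<le> 4"
  proof -
    have "m \<le> (\<Sum>a\<in>radical. 1)" unfolding m_def by (rule sum_mono) (simp add: v_def)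
    then show ?thesis using card_radical by simp
  qed
  ultimately show ?thesis using that eq by blast
qed

end

section \<open>The normalized inverse roots\<close>

lemma power_12_eq_1:
  fixes z :: complex and m :: int
  assumes "0 \<le> m" "m \<le> 4" and z: "(z + 1)\<^sup>2 = of_int m * z"
  shows "z ^ 12 = 1"
proof -
  have z2: "z ^ 2 = (of_int m - 2) * z - 1"
    using z by (simp add: power2_eq_square algebra_simps)
  consider "m = 0" | "m = 1" | "m = 2" | "m = 3" | "m = 4" using assms by linarith
  then show ?thesis
  proof cases
    case 1
    then have "z = - 1" using z by (simp add: add_eq_0_iff2)
    then show ?thesis by simp
  next
    case 2
    then have "z\<^sup>2 + z + 1 = 0" using z2 by simp
    moreover have "z ^ 3 - 1 = (z - 1) * (z\<^sup>2 + z + 1)"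
      by (simp add: eval_nat_numeral algebra_simps)
    ultimately have "z ^ 3 = 1" by (metis eq_iff_diff_eq_0 mult_zero_right)
    then have "(z ^ 3) ^ 4 = 1" by simp
    then show ?thesis by (simp flip: power_mult)
  next
    case 3
    then have "(z ^ 2) ^ 6 = 1" using z2 by simp
    then show ?thesis by (simp flip: power_mult)
  next
    case 4
    then have "z\<^sup>2 - z + 1 = 0" using z2 by simp
    moreover have "z ^ 3 + 1 = (z + 1) * (z\<^sup>2 - z + 1)"
      by (simp add: eval_nat_numeral algebra_simps)
    ultimately have "z ^ 3 = - 1" by (metis eq_neg_iff_add_eq_0 mult_zero_right)
    then have "(z ^ 3) ^ 4 = 1" by simp
    then show ?thesis by (simp flip: power_mult)
  next
    case 5
    then have "(z - 1)\<^sup>2 = 0" using z by (simp add: power2_eq_square algebra_simps)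
    then show ?thesis by simp
  qed
qed

lemma inverse_root_power_24:
  fixes \<alpha> \<beta> \<epsilon> :: complex and m :: int
  assumes m: "0 \<le> m" "m \<le> 4" and \<epsilon>: "\<epsilon> ^ 4 = 1"
    and prod: "\<alpha> * \<beta> = \<epsilon>" and sum: "(\<alpha> + \<beta>)\<^sup>2 = \<epsilon> * of_int m"
  shows "\<alpha> ^ 24 = 1"
proof -
  have \<epsilon>0: "\<epsilon> \<noteq> 0" using \<epsilon> by auto
  have "(\<alpha>\<^sup>2 + \<epsilon>)\<^sup>2 = (\<alpha> * (\<alpha> + \<beta>))\<^sup>2"
    using prod by (simp add: power2_eq_square algebra_simps)
  also have "\<dots> = \<alpha>\<^sup>2 * (\<epsilon> * of_int m)" by (simp add: power_mult_distrib sum)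
  finally have "(\<alpha>\<^sup>2 / \<epsilon> + 1)\<^sup>2 = of_int m * (\<alpha>\<^sup>2 / \<epsilon>)"
    using \<epsilon>0 by (simp add: field_simps power2_eq_square)
  then have "(\<alpha>\<^sup>2 / \<epsilon>) ^ 12 = 1" by (rule power_12_eq_1[OF m])
  then have "\<alpha> ^ 24 = \<epsilon> ^ 12"
    using \<epsilon>0 by (simp add: power_divide flip: power_mult)
  also have "\<dots> = (\<epsilon> ^ 4) ^ 3" by (simp flip: power_mult)
  finally show ?thesis using \<epsilon> by simp
qed

section \<open>Characters of the monic polynomials\<close>

lemma monic_mult: "F \<in> monic_polys \<Longrightarrow> G \<in> monic_polys \<Longrightarrow> F * G \<in> monic_polys"
  by (simp add: monic_polys_def lead_coeff_mult)

lemma G_chars_mult: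
  assumes "\<chi> \<in> G_chars l" "F \<in> monic_polys" "G \<in> monic_polys"
  shows "\<chi> (F * G) = \<chi> F * \<chi> G"
proof -
  obtain \<psi> where \<psi>: "\<psi> \<in> hom (R_group l) complex_units"
    and \<chi>: "\<chi> = (\<lambda>f\<in>monic_polys. \<psi> (R_rel l `` {f}))"
    using assms(1) by (auto simp: G_chars_def)
  have *: "R_rel l `` {F} \<in> carrier (R_group l)" "R_rel l `` {G} \<in> carrier (R_group l)"
    using assms by (auto simp: R_group_def quotientI)
  then show ?thesis
    using hom_mult[OF \<psi> *] R_group_mult[OF assms(2,3), of l] assms(2,3)
    by (simp add: \<chi> monic_mult complex_units_def)
qed

lemma G_chars_nonzero:
  assumes "\<chi> \<in> G_chars l" "F \<in> monic_polys"
  shows "\<chi> F \<noteq> 0"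
proof -
  obtain \<psi> where \<psi>: "\<psi> \<in> hom (R_group l) complex_units"
    and \<chi>: "\<chi> = (\<lambda>f\<in>monic_polys. \<psi> (R_rel l `` {f}))"
    using assms(1) by (auto simp: G_chars_def)
  have "R_rel l `` {F} \<in> carrier (R_group l)"
    using assms by (auto simp: R_group_def quotientI)
  then show ?thesis
    using hom_in_carrier[OF \<psi>] assms(2) by (auto simp: \<chi> complex_units_def)
qed

lemma G_chars_cong:
  assumes "\<chi> \<in> G_chars l" "(F, G) \<in> R_rel l"
  shows "\<chi> F = \<chi> G"
proof -
  have "F \<in> monic_polys" "G \<in> monic_polys" using assms(2) by (auto simp: R_rel_def)
  moreover have "R_rel l `` {F} = R_rel l `` {G}"
    using equiv_class_eq[OF equiv_R_rel assms(2)] .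
  ultimately show ?thesis using assms(1) by (auto simp: G_chars_def)
qed

text \<open>A criterion for a character to factor through a coarser relation.\<close>

lemma G_charsI:
  fixes \<chi> :: "'a::{field, finite} poly \<Rightarrow> complex"
  assumes ext: "\<chi> \<in> extensional monic_polys"
    and mult: "\<And>F G. F \<in> monic_polys \<Longrightarrow> G \<in> monic_polys \<Longrightarrow> \<chi> (F * G) = \<chi> F * \<chi> G"
    and nonzero: "\<And>F. F \<in> monic_polys \<Longrightarrow> \<chi> F \<noteq> 0"
    and cong: "\<And>F G. (F, G) \<in> R_rel l \<Longrightarrow> \<chi> F = \<chi> G"
  shows "\<chi> \<in> G_chars l"
proof -
  define \<psi> where "\<psi> C = \<chi> (SOME F. F \<in> C)" for C
  have \<psi>: "\<psi> (R_rel l `` {F}) = \<chi> F" if "F \<in> monic_polys" for F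
  proof -
    have "F \<in> R_rel l `` {F}" using that by (auto simp: R_rel_def)
    then have "(SOME G. G \<in> R_rel l `` {F}) \<in> R_rel l `` {F}" by (rule someI)
    then show ?thesis using cong by (auto simp: \<psi>_def)
  qed
  have "\<psi> \<in> hom (R_group l) complex_units"
  proof (rule homI)
    fix A :: "'a poly set" assume "A \<in> carrier (R_group l)"
    then obtain F where "F \<in> monic_polys" "A = R_rel l `` {F}"
      by (auto simp: R_group_def quotient_def)
    then show "\<psi> A \<in> carrier complex_units" by (simp add: \<psi> nonzero complex_units_def)
  next
    fix A B :: "'a poly set" assume "A \<in> carrier (R_group l)" "B \<in> carrier (R_group l)"
    then obtain F G where "F \<in> monic_polys" "A = R_rel l `` {F}" "G \<in> monic_polys" "B = R_rel l `` {G}"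
      by (auto simp: R_group_def quotient_def)
    then show "\<psi> (A \<otimes>\<^bsub>R_group l\<^esub> B) = \<psi> A \<otimes>\<^bsub>complex_units\<^esub> \<psi> B"
      by (simp add: R_group_mult \<psi> monic_mult mult complex_units_def)
  qed
  moreover have "\<chi> = (\<lambda>f\<in>monic_polys. \<psi> (R_rel l `` {f}))"
    using ext by (auto simp: \<psi> extensional_def)
  ultimately show ?thesis by (auto simp: G_chars_def)
qed

lemma monic_pCons [simp]:
  "[:a, 1:] \<in> monic_polys" "[:b, a, 1:] \<in> monic_polys" "[:c, b, a, 1:] \<in> monic_polys"
  by (simp_all add: monic_polys_def)

lemma next_coeff_0: "F \<in> monic_polys \<Longrightarrow> next_coeff 0 F = 1"
  by (simp add: next_coeff_def monic_polys_def)

lemma R_rel_3_iff: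
  "(F, G) \<in> R_rel 3 \<longleftrightarrow> F \<in> monic_polys \<and> G \<in> monic_polys \<and>
     next_coeff 1 F = next_coeff 1 G \<and> next_coeff 2 F = next_coeff 2 G \<and>
     next_coeff 3 F = next_coeff 3 G"
proof -
  have "{1..3} = {1, 2, 3::nat}" by auto
  then show ?thesis by (auto simp: R_rel_def)
qed

lemma next_coeffs_mult:
  assumes "F \<in> monic_polys" "G \<in> monic_polys"
  shows "next_coeff 1 (F * G) = next_coeff 1 F + next_coeff 1 G"
    and "next_coeff 2 (F * G) = next_coeff 2 F + next_coeff 1 F * next_coeff 1 G + next_coeff 2 G"
    and "next_coeff 3 (F * G) = next_coeff 3 F + next_coeff 2 F * next_coeff 1 G
           + next_coeff 1 F * next_coeff 2 G + next_coeff 3 G"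
  using assms by (simp_all add: next_coeff_mult next_coeff_0 eval_nat_numeral algebra_simps)

lemma next_coeffs_pCons:
  "next_coeff 1 [:a, 1:] = a" "next_coeff 2 [:a, 1:] = 0" "next_coeff 3 [:a, 1:] = 0"
  "next_coeff 1 [:b, a, 1:] = a" "next_coeff 2 [:b, a, 1:] = b" "next_coeff 3 [:b, a, 1:] = 0"
  "next_coeff 1 [:c, b, a, 1:] = a" "next_coeff 2 [:c, b, a, 1:] = b" "next_coeff 3 [:c, b, a, 1:] = c"
  by (simp_all add: next_coeff_def eval_nat_numeral)

text \<open>
  If \<open>\<chi>\<close> were trivial on the \<open>T\<^sup>3 + c\<close>, it would not depend on the third next-to-leading
  coefficient: multiplication by \<open>T\<^sup>3 + c\<close> adds \<open>c\<close> to that coefficient and leaves the first two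
  unchanged.
\<close>

lemma primitive_3_nontrivial:
  fixes \<chi> :: "'a::{field, finite} poly \<Rightarrow> complex"
  assumes "primitive_char 3 \<chi>"
  shows "\<exists>c. \<chi> [:c, 0, 0, 1:] \<noteq> 1"
proof (rule ccontr)
  assume "\<not> ?thesis"
  then have triv: "\<chi> [:c, 0, 0, 1:] = 1" for c by blast
  have G3: "\<chi> \<in> G_chars 3" and G2: "\<chi> \<notin> G_chars 2"
    using assms by (auto simp: primitive_char_def)
  have "\<chi> \<in> G_chars 2"
  proof (rule G_charsI)
    show "\<chi> \<in> extensional monic_polys" using G3 by (auto simp: G_chars_def)
  next
    fix F G :: "'a poly" assume FG: "(F, G) \<in> R_rel 2"
    have "{1..2} = {1, 2::nat}" by auto
    then have monic: "F \<in> monic_polys" "G \<in> monic_polys"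
      and nc: "next_coeff 1 F = next_coeff 1 G" "next_coeff 2 F = next_coeff 2 G"
      using FG by (auto simp: R_rel_def)
    define c where "c = next_coeff 3 G - next_coeff 3 F"
    have "(F * [:c, 0, 0, 1:], G) \<in> R_rel 3"
      using monic nc
      by (simp add: R_rel_3_iff next_coeffs_mult next_coeffs_pCons monic_mult c_def del: mult_pCons_right One_nat_def)
    then have "\<chi> (F * [:c, 0, 0, 1:]) = \<chi> G" by (rule G_chars_cong[OF G3])
    then show "\<chi> F = \<chi> G"
      using G_chars_mult[OF G3 monic(1), of "[:c, 0, 0, 1:]"] triv[of c] by (simp del: mult_pCons_right)
  qed (use G3 G_chars_mult G_chars_nonzero in blast)+
  with G2 show False by blast
qed

lemma monic_degree_1: "{F \<in> monic_polys :: 'a::{field, finite} poly set. degree F = 1} = range (\<lambda>a. [:a, 1:])"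
proof (intro Set.set_eqI iffI)
  fix F :: "'a poly" assume F: "F \<in> {F \<in> monic_polys. degree F = 1}"
  have "F = [:coeff F 0, 1:]"
  proof (rule poly_eqI)
    fix n
    show "coeff F n = coeff [:coeff F 0, 1:] n"
      using F by (cases n; cases "n - 1") (auto simp: monic_polys_def coeff_eq_0)
  qed
  then show "F \<in> range (\<lambda>a. [:a, 1:])" by blast
qed auto

lemma monic_degree_2: "{F \<in> monic_polys :: 'a::{field, finite} poly set. degree F = 2} = range (\<lambda>(a, b). [:b, a, 1:])"
proof (intro Set.set_eqI iffI)
  fix F :: "'a poly" assume F: "F \<in> {F \<in> monic_polys. degree F = 2}"
  have "F = [:coeff F 0, coeff F 1, 1:]"
  proof (rule poly_eqI)
    fix n :: nat
    consider "n = 0" | "n = 1" | "n = 2" | "n > 2" by linarith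
    then show "coeff F n = coeff [:coeff F 0, coeff F 1, 1:] n"
    proof cases
      case 4
      then have "coeff [:coeff F 0, coeff F 1, 1:] n = 0" by (intro coeff_eq_0) simp
      then show ?thesis using F 4 by (simp add: coeff_eq_0)
    qed (use F in \<open>auto simp: monic_polys_def eval_nat_numeral\<close>)
  qed
  then show "F \<in> range (\<lambda>(a, b). [:b, a, 1:])" by (metis case_prod_conv rangeI)
qed auto

lemma L_fun_nth_1: "fps_nth (L_fun \<chi>) 1 = (\<Sum>a\<in>UNIV. \<chi> [:a, 1:])"
  by (simp add: L_fun_def monic_degree_1[unfolded One_nat_def] sum.reindex inj_on_def)

lemma L_fun_nth_2: "fps_nth (L_fun \<chi>) 2 = (\<Sum>a\<in>UNIV. \<Sum>b\<in>UNIV. \<chi> [:b, a, 1:])"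
  by (simp add: L_fun_def monic_degree_2 sum.reindex inj_on_def sum.cartesian_product split_def)

theorem lemma3p5:
  fixes q r :: nat
    and \<chi> :: "'a::{field, finite} poly \<Rightarrow> complex"
    and \<gamma>\<^sub>1 \<gamma>\<^sub>2 :: complex
  assumes "r \<ge> 1" and "q = 2 ^ r" and "CARD('a) = q"
    and "primitive_char 3 \<chi>"
    and "L_fun \<chi> = (1 - fps_const \<gamma>\<^sub>1 * fps_X) * (1 - fps_const \<gamma>\<^sub>2 * fps_X)"
  shows "(\<gamma>\<^sub>1 / complex_of_real (sqrt (real q))) ^ 24 = 1
       \<and> (\<gamma>\<^sub>2 / complex_of_real (sqrt (real q))) ^ 24 = 1"
proof -
  have two: "(2::'a) = 0" using assms(2,3) by (intro two_eq_0_of_card) simp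
  have add_self: "x + x = 0" for x :: 'a using two by (metis mult_2 mult_zero_left)
  have G3: "\<chi> \<in> G_chars 3" using assms(4) by (simp add: primitive_char_def)
  define f where "f a = \<chi> [:a, 1:]" for a
  define g where "g b = \<chi> [:b, 0, 1:]" for b
  define h where "h c = \<chi> [:c, 0, 0, 1:]" for c
  note nc = R_rel_3_iff next_coeffs_mult next_coeffs_pCons monic_mult
  note \<chi>_mult = G_chars_mult[OF G3, symmetric]
  have g: "add_char g"
    unfolding add_char_def g_def
    by (auto simp: \<chi>_mult G_chars_nonzero[OF G3] nc simp del: mult_pCons_right mult_pCons_left One_nat_def
          intro!: G_chars_cong[OF G3])
  have h: "add_char h"
    unfolding add_char_def h_def
    by (auto simp: \<chi>_mult G_chars_nonzero[OF G3] nc simp del: mult_pCons_right mult_pCons_left One_nat_def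
          intro!: G_chars_cong[OF G3])
  \<comment> \<open>\<open>(1 + a x) (1 + b x\<^sup>2) (1 + c x\<^sup>3) = 1 + a x + b x\<^sup>2 + (a b + c) x\<^sup>3\<close> modulo \<open>x\<^sup>4\<close>;
    the choice \<open>c = a b\<close> makes the last coefficient vanish.\<close>
  have decomp: "\<chi> [:b, a, 1:] = f a * g b * h (a * b)" for a b
    unfolding f_def g_def h_def
    by (auto simp: \<chi>_mult nc add_self simp del: mult_pCons_right mult_pCons_left One_nat_def
          intro!: G_chars_cong[OF G3])
  have "f a * f b = \<chi> [:a * b, a + b, 1:]" for a b
    by (simp add: f_def \<chi>_mult algebra_simps)
  then have f_mult: "f a * f b = f (a + b) * g (a * b) * h (a * b * (a + b))" for a b
    by (simp add: decomp mult_ac)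
  have h1: "\<exists>c. h c \<noteq> 1" using primitive_3_nontrivial[OF assms(4)] by (simp add: h_def)
  then obtain e where e: "\<And>b. g b = h (e * b)" using add_char_dual[OF g h] by metis
  interpret char_data f g h e
    by unfold_locales (use two g h h1 f_mult e in \<open>auto simp: f_def G_chars_nonzero[OF G3]\<close>)
  let ?S = "\<Sum>a\<in>UNIV. f a"
  obtain m where m: "0 \<le> m" "m \<le> 4" and norm: "?S * cnj ?S = of_nat CARD('a) * of_int m"
    by (rule norm_first_coeff)
  have "fps_nth (L_fun \<chi>) 1 = - (\<gamma>\<^sub>1 + \<gamma>\<^sub>2)" and "fps_nth (L_fun \<chi>) 2 = \<gamma>\<^sub>1 * \<gamma>\<^sub>2"
    by (simp_all add: assms(5) fps_mult_nth eval_nat_numeral)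
  then have sum: "\<gamma>\<^sub>1 + \<gamma>\<^sub>2 = - ?S" and prod: "\<gamma>\<^sub>1 * \<gamma>\<^sub>2 = of_nat q * f e"
    using second_coeff
    by (simp_all add: L_fun_nth_1[unfolded One_nat_def] L_fun_nth_2 decomp f_def assms(3))
  have "(\<gamma>\<^sub>1 + \<gamma>\<^sub>2)\<^sup>2 = ?S * (f e * cnj ?S)"
    unfolding sum by (metis functional_equation power2_eq_square power2_minus)
  then have sq: "(\<gamma>\<^sub>1 + \<gamma>\<^sub>2)\<^sup>2 = of_nat q * (f e * of_int m)"
    using norm by (simp add: assms(3) mult_ac)
  define w where "w = complex_of_real (sqrt (real q))"
  have w2: "w * w = of_nat q"
    by (simp add: w_def flip: of_real_mult)
  have q0: "(of_nat q :: complex) \<noteq> 0" using assms(2) by simp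
  have p': "(\<gamma>\<^sub>1 / w) * (\<gamma>\<^sub>2 / w) = f e"
    using prod q0 by (simp add: w2)
  have s': "(\<gamma>\<^sub>1 / w + \<gamma>\<^sub>2 / w)\<^sup>2 = f e * of_int m"
    using sq q0 by (simp add: power2_eq_square w2 flip: add_divide_distrib)
  have "(\<gamma>\<^sub>1 / w) ^ 24 = 1"
    by (rule inverse_root_power_24[OF m f_4 p' s'])
  moreover have "(\<gamma>\<^sub>2 / w) ^ 24 = 1"
    using p' s' by (intro inverse_root_power_24[OF m f_4]) (simp_all add: mult.commute add.commute)
  ultimately show ?thesis by (simp add: w_def)
qed

end
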